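(* Let $\beta>0$. When $\beta$ is known, there does not exist any sequence of estimators which is consistent for $p\in U_\beta$, based on a single sample $\boldsymbol X=(X_1,\ldots,X_N)$ from the $p$-spin Curie-Weiss model $\mathbb{P}_{\beta,p}$ on $\{-1,1\}^N$.
   Context: For $\beta>0$, an integer $p\ge 2$ and $N\ge 1$, the $p$-spin Curie-Weiss model is the probability measure on $\{-1,1\}^N$ given by $\mathbb{P}_{\beta,p}(\boldsymbol x)=\exp\{\beta N\bar x^{\,p}\}/Z_N(\beta,p)$, where $\bar x=\frac1N\sum_{i=1}^N x_i$ and $Z_N(\beta,p)$ is the normalizing constant (the dependence of $\mathbb{P}_{\beta,p}$ on $N$ is suppressed). For $x\in[0,1]$ let $H_{\beta,p}(x)=\beta x^p-\frac12\{(1+x)\log(1+x)+(1-x)\log(1-x)\}$, with the convention $0\log 0=0$. Define $\beta^*(p)=\sup\{\beta>0:\sup_{x\in[0,1]}H_{\beta,p}(x)=0\}$. For $\beta>0$, $U_\beta=\{p\ge 2 \text{ integer}:\beta^*(p)>\beta\}$. An estimator is a (measurable) real-valued function $T_N(\boldsymbol X)$ of the sample, which may depend on the known $\beta$. A sequence $(T_N)_{N\ge1}$ is consistent for $p\in U_\beta$ if for every $p\in U_\beta$ and every $\varepsilon>0$, $\mathbb{P}_{\beta,p}(|T_N(\boldsymbol X)-p|>\varepsilon)\to0$ as $N\to\infty$.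
   Formalization: The set U_β is additionally assumed to be nonempty; for β ≥ log 2 it is empty, so every sequence of estimators is vacuously consistent and the claim as stated for all β > 0 fails. *)

theory Defs
  imports "HOL-Probability.Probability"
begin

definition spins :: "nat \<Rightarrow> (nat \<Rightarrow> real) set" where
  "spins N = {1..N} \<rightarrow>\<^sub>E {-1, 1}"

definition sample_mean :: "nat \<Rightarrow> (nat \<Rightarrow> real) \<Rightarrow> real" where
  "sample_mean N x = (\<Sum>i=1..N. x i) / real N"

definition cw_Z :: "nat \<Rightarrow> real \<Rightarrow> nat \<Rightarrow> real" where
  "cw_Z N \<beta> p = (\<Sum>x\<in>spins N. exp (\<beta> * real N * sample_mean N x ^ p))"

definition curie_weiss :: "nat \<Rightarrow> real \<Rightarrow> nat \<Rightarrow> (nat \<Rightarrow> real) measure" where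
  "curie_weiss N \<beta> p = point_measure (spins N)
     (\<lambda>x. ennreal (exp (\<beta> * real N * sample_mean N x ^ p) / cw_Z N \<beta> p))"

text \<open>The convention \<open>0 log 0 = 0\<close>, needed at \<open>x = 1\<close>, is built in because \<open>ln 0 = 0\<close> in HOL.\<close>

definition cw_H :: "real \<Rightarrow> nat \<Rightarrow> real \<Rightarrow> real" where
  "cw_H \<beta> p x = \<beta> * x ^ p - 1/2 * ((1 + x) * ln (1 + x) + (1 - x) * ln (1 - x))"

text \<open>For \<open>p \<ge> 2\<close> both suprema are over nonempty sets that are bounded above (the outer one by
  \<open>ln 2\<close>, since \<open>cw_H \<beta> p 1 = \<beta> - ln 2\<close>), so the conditionally complete supremum on the reals is
  the intended one.\<close>

definition beta_star :: "nat \<Rightarrow> real" where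
  "beta_star p = Sup {\<beta>. \<beta> > 0 \<and> (SUP x\<in>{0..1}. cw_H \<beta> p x) = 0}"

definition U_set :: "real \<Rightarrow> nat set" where
  "U_set \<beta> = {p. p \<ge> 2 \<and> beta_star p > \<beta>}"

text \<open>The \<open>\<sigma>\<close>-algebra of \<open>curie_weiss N \<beta> p\<close> is the power set of \<open>spins N\<close>, whatever \<open>\<beta>\<close> and \<open>p\<close>
  are, so estimators are measurable with respect to the discrete structure on \<open>spins N\<close>.\<close>

definition estimator_seq :: "(nat \<Rightarrow> (nat \<Rightarrow> real) \<Rightarrow> real) \<Rightarrow> bool" where
  "estimator_seq T \<longleftrightarrow> (\<forall>N\<ge>1. T N \<in> borel_measurable (count_space (spins N)))"

definition consistent_on_U :: "real \<Rightarrow> (nat \<Rightarrow> (nat \<Rightarrow> real) \<Rightarrow> real) \<Rightarrow> bool" where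
  "consistent_on_U \<beta> T \<longleftrightarrow> (\<forall>p\<in>U_set \<beta>. \<forall>\<epsilon>>0.
     (\<lambda>N. \<P>(x in curie_weiss N \<beta> p. \<bar>T N x - real p\<bar> > \<epsilon>)) \<longlonglongrightarrow> 0)"

lemma finite_spins: "finite (spins N)"
  unfolding spins_def by (intro finite_PiE) auto

lemma spins_nonempty: "spins N \<noteq> {}"
  unfolding spins_def by (simp add: PiE_eq_empty_iff)

lemma cw_Z_pos: "cw_Z N \<beta> p > 0"
  unfolding cw_Z_def by (intro sum_pos finite_spins spins_nonempty) simp

lemma space_curie_weiss: "space (curie_weiss N \<beta> p) = spins N"
  by (simp add: curie_weiss_def space_point_measure)

lemma sets_curie_weiss: "sets (curie_weiss N \<beta> p) = sets (count_space (spins N))"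
  by (simp add: curie_weiss_def sets_point_measure)

lemma prob_space_curie_weiss: "prob_space (curie_weiss N \<beta> p)"
proof
  have "emeasure (curie_weiss N \<beta> p) (spins N) =
      (\<Sum>x\<in>spins N. ennreal (exp (\<beta> * real N * sample_mean N x ^ p) / cw_Z N \<beta> p))"
    unfolding curie_weiss_def
    by (rule emeasure_point_measure_finite) (simp_all add: finite_spins)
  also have "\<dots> = ennreal (\<Sum>x\<in>spins N. exp (\<beta> * real N * sample_mean N x ^ p) / cw_Z N \<beta> p)"
    by (intro sum_ennreal) (simp add: cw_Z_pos less_imp_le)
  also have "(\<Sum>x\<in>spins N. exp (\<beta> * real N * sample_mean N x ^ p) / cw_Z N \<beta> p) = 1"
    using cw_Z_pos[of N \<beta> p] by (simp add: cw_Z_def flip: sum_divide_distrib)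
  finally show "emeasure (curie_weiss N \<beta> p) (space (curie_weiss N \<beta> p)) = 1"
    by (simp add: space_curie_weiss)
qed

end

theory Submission
  imports Defs
begin

text \<open>Write \<open>J\<close> for the entropy part of \<open>cw_H\<close>. Chernoff's bound states that, for \<open>x\<close> uniform on
  the spins and \<open>m = sample_mean N x\<close>, the variable \<open>N J(|m|)\<close> has tail at most \<open>2 exp (-s)\<close>.
  If \<open>\<beta> < beta_star p\<close>, then \<open>\<beta> |m|^p \<le> c J(|m|)\<close> for some \<open>c < 1\<close>, so the normalizing constant
  is bounded by a constant multiple of \<open>2^N\<close>. For even \<open>p\<close> the unnormalized weights are at least \<open>1\<close>,
  so an event which is asymptotically null for the model is asymptotically null for the uniform
  measure. As \<open>U_set \<beta>\<close> is upward closed, it contains two even numbers, and an estimator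
  consistent for both would have to be close to both with high uniform probability.\<close>

section \<open>Entropy and a quadratic lower bound\<close>

definition cw_entropy :: "real \<Rightarrow> real" where
  "cw_entropy x = 1/2 * ((1 + x) * ln (1 + x) + (1 - x) * ln (1 - x))"

lemma cw_H_eq: "cw_H \<beta> p x = \<beta> * x ^ p - cw_entropy x"
  by (simp add: cw_H_def cw_entropy_def)

lemma cw_entropy_0 [simp]: "cw_entropy 0 = 0"
  by (simp add: cw_entropy_def)

text \<open>This is \<open>ln u \<le> u - 1\<close> at \<open>u = 1 / sqrt a\<close>; passing to
  square roots makes the entropy bound below purely algebraic.\<close>

lemma mult_ln_ge_sqrt:
  fixes a :: real
  assumes "a \<ge> 0"
  shows "a * ln a \<ge> 2 * a - 2 * sqrt a"
proof (cases "a = 0")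
  case False
  with assms have a: "a > 0" by simp
  have "ln (1 / sqrt a) \<le> 1 / sqrt a - 1"
    using a by (intro ln_le_minus_one) simp
  moreover have "ln (1 / sqrt a) = - ln a / 2"
    using a by (simp add: ln_div ln_sqrt)
  ultimately have "ln a \<ge> 2 - 2 / sqrt a" by simp
  then have "a * ln a \<ge> a * (2 - 2 / sqrt a)"
    using a by (intro mult_left_mono) auto
  also have "a * (2 - 2 / sqrt a) = 2 * a - 2 * (a / sqrt a)"
    by (simp add: algebra_simps)
  also have "a / sqrt a = sqrt a"
    using a by (simp add: real_div_sqrt)
  finally show ?thesis .
qed simp

text \<open>With \<open>a\<close> and \<open>b\<close> the square roots of \<open>1 + x\<close> and
  \<open>1 - x\<close>, the previous bound gives entropy at least \<open>2 - a - b\<close>, and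
  comparing squares gives \<open>a + b \<le> 2 - x^2 / 4\<close>.\<close>

lemma cw_entropy_ge:
  assumes "0 \<le> x" "x \<le> 1"
  shows "cw_entropy x \<ge> x\<^sup>2 / 4"
proof -
  define a where "a = sqrt (1 + x)"
  define b where "b = sqrt (1 - x)"
  have sq: "a\<^sup>2 = 1 + x" "b\<^sup>2 = 1 - x"
    using assms by (auto simp: a_def b_def)
  have x2: "x\<^sup>2 \<le> 1" using assms by (simp add: power_le_one)
  have "a * b = sqrt (1 - x\<^sup>2)"
    by (simp add: a_def b_def algebra_simps power2_eq_square flip: real_sqrt_mult)
  also have "\<dots> \<le> 1 - x\<^sup>2 / 2"
  proof (rule real_le_lsqrt)
    have "1 - x\<^sup>2 \<le> 1 - x\<^sup>2 + (x\<^sup>2 / 2)\<^sup>2" by simp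
    also have "\<dots> = (1 - x\<^sup>2 / 2)\<^sup>2" by (simp add: power2_eq_square algebra_simps)
    finally show "1 - x\<^sup>2 \<le> (1 - x\<^sup>2 / 2)\<^sup>2" .
  qed (use x2 in auto)
  finally have ab: "a * b \<le> 1 - x\<^sup>2 / 2" .
  have "a + b \<le> 2 - x\<^sup>2 / 4"
  proof (rule power2_le_imp_le)
    have "(a + b)\<^sup>2 = a\<^sup>2 + b\<^sup>2 + 2 * (a * b)" by (simp add: power2_sum)
    also have "\<dots> \<le> 4 - x\<^sup>2" using ab sq by simp
    also have "\<dots> \<le> 4 - x\<^sup>2 + (x\<^sup>2 / 4)\<^sup>2" by simp
    also have "\<dots> = (2 - x\<^sup>2 / 4)\<^sup>2" by (simp add: power2_eq_square algebra_simps)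
    finally show "(a + b)\<^sup>2 \<le> (2 - x\<^sup>2 / 4)\<^sup>2" .
  qed (use x2 in auto)
  moreover have "(1 + x) * ln (1 + x) \<ge> 2 * (1 + x) - 2 * a"
    and "(1 - x) * ln (1 - x) \<ge> 2 * (1 - x) - 2 * b"
    using mult_ln_ge_sqrt[of "1 + x"] mult_ln_ge_sqrt[of "1 - x"] assms
    by (auto simp: a_def b_def)
  ultimately show ?thesis
    unfolding cw_entropy_def by (simp add: algebra_simps)
qed

lemma cw_entropy_nonneg: "0 \<le> x \<Longrightarrow> x \<le> 1 \<Longrightarrow> cw_entropy x \<ge> 0"
  by (rule order_trans[OF _ cw_entropy_ge]) auto

section \<open>The threshold as an entropy inequality\<close>

text \<open>\<open>cw_H\<close> vanishes at \<open>0\<close>, so its supremum is never negative and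
  is \<open>0\<close> exactly when \<open>cw_H\<close> is nowhere positive.\<close>

lemma SUP_cw_H_eq_0_iff:
  assumes "\<beta> > 0" "p \<ge> 2"
  shows "(SUP x\<in>{0..1}. cw_H \<beta> p x) = 0 \<longleftrightarrow> (\<forall>x\<in>{0..1}. \<beta> * x ^ p \<le> cw_entropy x)"
proof
  have bdd: "bdd_above (cw_H \<beta> p ` {0..1})"
  proof (rule bdd_aboveI2)
    fix x :: real assume x: "x \<in> {0..1}"
    then have "\<beta> * x ^ p \<le> \<beta> * 1" using assms by (intro mult_left_mono power_le_one) auto
    then show "cw_H \<beta> p x \<le> \<beta>"
      using cw_entropy_nonneg[of x] x by (simp add: cw_H_eq)
  qed
  {
    assume S: "(SUP x\<in>{0..1}. cw_H \<beta> p x) = 0"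
    show "\<forall>x\<in>{0..1}. \<beta> * x ^ p \<le> cw_entropy x"
    proof
      fix x :: real assume "x \<in> {0..1}"
      from cSUP_upper[OF this bdd] S show "\<beta> * x ^ p \<le> cw_entropy x"
        by (simp add: cw_H_eq)
    qed
  next
    assume le: "\<forall>x\<in>{0..1}. \<beta> * x ^ p \<le> cw_entropy x"
    have "cw_H \<beta> p 0 \<le> (SUP x\<in>{0..1}. cw_H \<beta> p x)"
      by (rule cSUP_upper[OF _ bdd]) simp
    moreover have "(SUP x\<in>{0..1}. cw_H \<beta> p x) \<le> 0"
      by (rule cSUP_least) (use le in \<open>auto simp: cw_H_eq\<close>)
    ultimately show "(SUP x\<in>{0..1}. cw_H \<beta> p x) = 0"
      using assms by (intro antisym) (auto simp: cw_H_eq zero_power)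
  }
qed

text \<open>Supplies a \<open>\<gamma>\<close> strictly above \<open>\<beta>\<close>; this slack
  later yields the factor \<open>c < 1\<close>.\<close>

lemma less_beta_star_iff:
  assumes "p \<ge> 2" "\<beta> > 0"
  shows "\<beta> < beta_star p \<longleftrightarrow> (\<exists>\<gamma>>\<beta>. \<forall>x\<in>{0..1}. \<gamma> * x ^ p \<le> cw_entropy x)"
proof -
  define S where "S = {\<gamma>. \<gamma> > 0 \<and> (\<forall>x\<in>{0..1}. \<gamma> * x ^ p \<le> cw_entropy x)}"
  have star: "beta_star p = Sup S"
    unfolding beta_star_def S_def using SUP_cw_H_eq_0_iff[OF _ assms(1)]
    by (metis (lifting))
  have "1/4 * x ^ p \<le> cw_entropy x" if "x \<in> {0..1}" for x
  proof -
    have "x ^ p \<le> x\<^sup>2" using that assms by (intro power_decreasing) auto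
    then show ?thesis using cw_entropy_ge[of x] that by simp
  qed
  \<comment> \<open>The quadratic entropy bound provides the member \<open>1/4\<close>, and
    evaluation at \<open>x = 1\<close> provides the upper bound of \<open>S\<close>.\<close>
  then have "1/4 \<in> S" unfolding S_def by simp
  moreover have "bdd_above S"
  proof (rule bdd_aboveI)
    fix \<gamma> assume "\<gamma> \<in> S"
    then have "\<gamma> * 1 ^ p \<le> cw_entropy 1" unfolding S_def by fastforce
    then show "\<gamma> \<le> cw_entropy 1" by simp
  qed
  ultimately have "\<beta> < beta_star p \<longleftrightarrow> (\<exists>\<gamma>\<in>S. \<beta> < \<gamma>)"
    unfolding star by (intro less_cSup_iff) auto
  also have "\<dots> \<longleftrightarrow> (\<exists>\<gamma>>\<beta>. \<forall>x\<in>{0..1}. \<gamma> * x ^ p \<le> cw_entropy x)"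
    unfolding S_def using assms(2) by (auto intro: less_trans)
  finally show ?thesis .
qed

text \<open>Powers decrease in the exponent on \<open>[0, 1]\<close>, so the \<open>\<gamma>\<close>
  for \<open>p\<close> also serves \<open>q\<close>.\<close>

lemma U_set_upward_closed:
  assumes "\<beta> > 0" "p \<in> U_set \<beta>" "p \<le> q"
  shows "q \<in> U_set \<beta>"
proof -
  have p: "p \<ge> 2" "\<beta> < beta_star p" using assms(2) by (auto simp: U_set_def)
  with assms(1) obtain \<gamma> where \<gamma>: "\<gamma> > \<beta>" "\<forall>x\<in>{0..1}. \<gamma> * x ^ p \<le> cw_entropy x"
    by (auto simp: less_beta_star_iff)
  have "\<gamma> * x ^ q \<le> cw_entropy x" if "x \<in> {0..1}" for x
  proof -
    have "\<gamma> * x ^ q \<le> \<gamma> * x ^ p"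
      using that assms \<gamma> by (intro mult_left_mono power_decreasing) auto
    with \<gamma> that show ?thesis by fastforce
  qed
  with \<gamma>(1) p(1) assms(1,3) show ?thesis
    by (auto simp: U_set_def less_beta_star_iff)
qed

section \<open>Chernoff's bound under the uniform measure\<close>

lemma spins_values: "x \<in> spins N \<Longrightarrow> i \<in> {1..N} \<Longrightarrow> x i \<in> {-1, 1}"
  by (auto simp: spins_def PiE_iff)

lemma card_spins: "card (spins N) = 2 ^ N"
  by (simp add: spins_def card_PiE card_insert_if numeral_2_eq_2)

lemma abs_sample_mean_le:
  assumes "x \<in> spins N" "N \<ge> 1"
  shows "\<bar>sample_mean N x\<bar> \<le> 1"
proof -
  have "\<bar>\<Sum>i=1..N. x i\<bar> \<le> (\<Sum>i=1..N. \<bar>x i\<bar>)" by (rule sum_abs)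
  also have "\<dots> \<le> (\<Sum>i=1..N. 1)"
    using spins_values[OF assms(1)] by (intro sum_mono) fastforce
  finally show ?thesis using assms(2) by (simp add: sample_mean_def)
qed

text \<open>The product weight is, up to the factor \<open>2^N\<close>, the density of the law of independent spins
  with mean \<open>t\<close>; it replaces the exponential tilt in Chernoff's bound and also covers \<open>t = 1\<close>.\<close>

lemma exp_entropy_le_tilt:
  fixes y :: "nat \<Rightarrow> real"
  assumes y: "\<And>i. i \<in> {1..N} \<Longrightarrow> y i \<in> {-1, 1}"
    and t: "0 \<le> t" "t \<le> 1" and m: "real N * t \<le> (\<Sum>i=1..N. y i)"
  shows "exp (real N * cw_entropy t) \<le> (\<Prod>i=1..N. 1 + t * y i)"
proof (cases "t = 1")
  case True
  \<comment> \<open>A mean of at least \<open>1\<close> forces every spin to be \<open>1\<close>;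
    both sides are then \<open>2 ^ N\<close>.\<close>
  have nonneg: "\<forall>i\<in>{1..N}. 1 - y i \<ge> 0" using y by fastforce
  have "(\<Sum>i=1..N. 1 - y i) \<le> 0" using m True by (simp add: sum_subtractf)
  then have "(\<Sum>i=1..N. 1 - y i) = 0" using sum_nonneg[of "{1..N}" "\<lambda>i. 1 - y i"] nonneg by auto
  then have "\<forall>i\<in>{1..N}. y i = 1"
    using sum_nonneg_eq_0_iff[of "{1..N}" "\<lambda>i. 1 - y i"] nonneg by auto
  then have "(\<Prod>i=1..N. 1 + t * y i) = 2 ^ N" using True by simp
  moreover have "exp (real N * cw_entropy t) = 2 ^ N"
    using True by (simp add: cw_entropy_def exp_of_nat_mult)
  ultimately show ?thesis by simp
next
  case False
  with t have t1: "t < 1" by simp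
  \<comment> \<open>\<open>A + B * y\<close> is the affine function that agrees with
    \<open>ln (1 + t * y)\<close> at \<open>y = 1\<close> and \<open>y = -1\<close>, and
    \<open>cw_entropy t = A + B * t\<close>.\<close>
  define A where "A = (ln (1 + t) + ln (1 - t)) / 2"
  define B where "B = (ln (1 + t) - ln (1 - t)) / 2"
  have "B \<ge> 0" unfolding B_def using t t1 by simp
  have "real N * cw_entropy t = real N * A + B * (real N * t)"
    by (simp add: cw_entropy_def A_def B_def field_simps)
  also have "\<dots> \<le> real N * A + B * (\<Sum>i=1..N. y i)"
    using m \<open>B \<ge> 0\<close> by (simp add: mult_left_mono)
  also have "\<dots> = (\<Sum>i=1..N. A + B * y i)"
    by (simp add: sum.distrib sum_distrib_left)
  finally have "exp (real N * cw_entropy t) \<le> exp (\<Sum>i=1..N. A + B * y i)" by simp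
  also have "\<dots> = (\<Prod>i=1..N. exp (A + B * y i))" by (simp add: exp_sum)
  also have "\<dots> = (\<Prod>i=1..N. 1 + t * y i)"
  proof (rule prod.cong[OF refl])
    fix i assume "i \<in> {1..N}"
    from y[OF this] consider "y i = 1" | "y i = -1" by auto
    then show "exp (A + B * y i) = 1 + t * y i"
      by cases (use t t1 in \<open>simp_all add: A_def B_def field_simps\<close>)
  qed
  finally show ?thesis .
qed

text \<open>The sum factorizes over coordinates, and each one contributes
  \<open>(1 - t) + (1 + t) = 2\<close>.\<close>

lemma sum_tilt: "(\<Sum>x\<in>spins N. \<Prod>i=1..N. 1 + t * x i) = (2::real) ^ N"
proof -
  have "(\<Sum>x\<in>spins N. \<Prod>i=1..N. 1 + t * x i) = (\<Prod>i=1..N. \<Sum>y\<in>{-1, 1}. 1 + t * y)"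
    unfolding spins_def by (subst prod_sum_PiE) auto
  then show ?thesis by simp
qed

text \<open>Markov's inequality for the sum \<open>w\<close> of the tilts by \<open>t\<close> and
  \<open>-t\<close>, one for each sign of the mean.\<close>

lemma card_abs_mean_ge:
  assumes "0 \<le> t" "t \<le> 1" "N \<ge> 1"
  shows "real (card {x\<in>spins N. t \<le> \<bar>sample_mean N x\<bar>}) \<le> 2 * 2 ^ N * exp (- real N * cw_entropy t)"
proof -
  define E where "E = {x\<in>spins N. t \<le> \<bar>sample_mean N x\<bar>}"
  define w where "w = (\<lambda>x::nat \<Rightarrow> real. (\<Prod>i=1..N. 1 + t * x i) + (\<Prod>i=1..N. 1 + (-t) * x i))"
  have pos: "(\<Prod>i=1..N. 1 + s * x i) \<ge> 0" if "x \<in> spins N" "\<bar>s\<bar> \<le> 1" for x s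
  proof (rule prod_nonneg)
    fix i assume "i \<in> {1..N}"
    from spins_values[OF that(1) this] that(2) show "0 \<le> 1 + s * x i" by auto
  qed
  have w: "exp (real N * cw_entropy t) \<le> w x" if "x \<in> E" for x
  proof -
    have x: "x \<in> spins N" and m: "t \<le> \<bar>sample_mean N x\<bar>" using that by (auto simp: E_def)
    have nonneg: "(\<Prod>i=1..N. 1 + t * x i) \<ge> 0" "(\<Prod>i=1..N. 1 + (-t) * x i) \<ge> 0"
      using pos[OF x, of t] pos[OF x, of "-t"] assms by auto
    show ?thesis
    proof (cases "t \<le> sample_mean N x")
      case True
      then have "real N * t \<le> (\<Sum>i=1..N. x i)"
        using assms by (simp add: sample_mean_def field_simps)
      with exp_entropy_le_tilt[of N x t] spins_values[OF x] assms nonneg show ?thesis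
        unfolding w_def by fastforce
    next
      case False
      with m have "t \<le> - sample_mean N x" by linarith
      then have "real N * t \<le> (\<Sum>i=1..N. - x i)"
        using assms by (simp add: sample_mean_def sum_negf field_simps)
      moreover have "- x i \<in> {-1, 1}" if "i \<in> {1..N}" for i
        using spins_values[OF x that] by auto
      ultimately have "exp (real N * cw_entropy t) \<le> (\<Prod>i=1..N. 1 + t * (- x i))"
        using assms by (intro exp_entropy_le_tilt) auto
      with nonneg show ?thesis unfolding w_def by simp
    qed
  qed
  have "real (card E) * exp (real N * cw_entropy t) = (\<Sum>x\<in>E. exp (real N * cw_entropy t))"
    by simp
  also have "\<dots> \<le> (\<Sum>x\<in>E. w x)" by (rule sum_mono[OF w])
  also have "\<dots> \<le> (\<Sum>x\<in>spins N. w x)"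
  proof (rule sum_mono2)
    fix x assume "x \<in> spins N - E"
    then show "0 \<le> w x" unfolding w_def using pos[of x t] pos[of x "-t"] assms by auto
  qed (auto simp: finite_spins E_def)
  also have "\<dots> = 2 * 2 ^ N"
    unfolding w_def sum.distrib using sum_tilt[of t N] sum_tilt[of "-t" N] by simp
  finally show ?thesis
    by (simp add: E_def exp_minus field_simps)
qed

lemma card_entropy_ge:
  assumes "N \<ge> 1"
  shows "real (card {x\<in>spins N. s \<le> real N * cw_entropy \<bar>sample_mean N x\<bar>}) \<le> 2 * 2 ^ N * exp (- s)"
proof (cases "{x\<in>spins N. s \<le> real N * cw_entropy \<bar>sample_mean N x\<bar>} = {}")
  case True
  then show ?thesis by (simp only: card.empty) simp
next
  case False
  define E where "E = {x\<in>spins N. s \<le> real N * cw_entropy \<bar>sample_mean N x\<bar>}"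
  have fin: "finite E" by (simp add: E_def finite_spins)
  \<comment> \<open>The least \<open>\<bar>sample_mean N x\<bar>\<close> on \<open>E\<close> is
    attained, so \<open>t\<close> itself satisfies the entropy condition while \<open>E\<close> lies
    in the tail event at \<open>t\<close>.\<close>
  define t where "t = Min ((\<lambda>x. \<bar>sample_mean N x\<bar>) ` E)"
  have ne: "E \<noteq> {}" using False by (simp add: E_def)
  then have "t \<in> (\<lambda>x. \<bar>sample_mean N x\<bar>) ` E"
    unfolding t_def using fin by (intro Min_in) auto
  then obtain z where z: "z \<in> spins N" "t = \<bar>sample_mean N z\<bar>" "s \<le> real N * cw_entropy t"
    by (auto simp: E_def)
  have "E \<subseteq> {x\<in>spins N. t \<le> \<bar>sample_mean N x\<bar>}"
    using fin by (auto simp: t_def E_def)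
  then have "real (card E) \<le> real (card {x\<in>spins N. t \<le> \<bar>sample_mean N x\<bar>})"
    by (simp add: card_mono finite_spins)
  also have "\<dots> \<le> 2 * 2 ^ N * exp (- real N * cw_entropy t)"
    using z abs_sample_mean_le[OF z(1) assms] assms by (intro card_abs_mean_ge) auto
  also have "\<dots> \<le> 2 * 2 ^ N * exp (- s)" using z(3) by simp
  finally show ?thesis by (simp add: E_def)
qed

section \<open>Boundedness of the normalized partition function\<close>

text \<open>Cutting the range of \<open>f\<close> into unit layers turns the sum into a geometric
  series of ratio \<open>exp (c - 1)\<close>, which is below \<open>1\<close> as
  \<open>c < 1\<close>.\<close>

lemma sum_exp_le_of_exp_tail:
  fixes f :: "'a \<Rightarrow> real"
  assumes fin: "finite S" and f: "\<And>x. x \<in> S \<Longrightarrow> f x \<ge> 0"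
    and tail: "\<And>s. real (card {x\<in>S. s \<le> f x}) \<le> M * exp (- s)"
    and c: "0 \<le> c" "c < 1"
  shows "(\<Sum>x\<in>S. exp (c * f x)) \<le> M * (exp c / (1 - exp (c - 1)))"
proof -
  have M: "M \<ge> 0" using tail[of 0] by (simp add: order_trans[OF of_nat_0_le_iff])
  \<comment> \<open>\<open>K\<close> exceeds the floor of every value of \<open>f\<close>; inserting
    \<open>0\<close> covers empty \<open>S\<close>.\<close>
  define K where "K = Suc (nat \<lfloor>Max (insert 0 (f ` S))\<rfloor>)"
  define r where "r = exp (c - 1)"
  have r: "0 < r" "r < 1" using c by (auto simp: r_def)
  have layer: "exp (c * f x) \<le> (\<Sum>k<K. exp (c * (real k + 1)) * of_bool (real k \<le> f x))"
    if x: "x \<in> S" for x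
  proof -
    define k where "k = nat \<lfloor>f x\<rfloor>"
    have "f x \<le> Max (insert 0 (f ` S))" using x fin by (intro Max_ge) auto
    then have kK: "k < K" unfolding k_def K_def by (simp add: floor_mono nat_mono less_Suc_eq_le)
    have k: "real k \<le> f x" "f x \<le> real k + 1" using f[OF x] unfolding k_def by linarith+
    have "exp (c * f x) \<le> exp (c * (real k + 1))" using k c by (simp add: mult_left_mono)
    also have "\<dots> = exp (c * (real k + 1)) * of_bool (real k \<le> f x)" using k by simp
    also have "\<dots> \<le> (\<Sum>k<K. exp (c * (real k + 1)) * of_bool (real k \<le> f x))"
      using kK by (intro member_le_sum) auto
    finally show ?thesis .
  qed
  have "(\<Sum>x\<in>S. exp (c * f x)) \<le>
      (\<Sum>x\<in>S. \<Sum>k<K. exp (c * (real k + 1)) * of_bool (real k \<le> f x))"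
    by (rule sum_mono[OF layer])
  also have "\<dots> = (\<Sum>k<K. \<Sum>x\<in>S. exp (c * (real k + 1)) * of_bool (real k \<le> f x))"
    by (rule sum.swap)
  also have "\<dots> = (\<Sum>k<K. exp (c * (real k + 1)) * real (card {x\<in>S. real k \<le> f x}))"
    using fin by (simp add: sum_of_bool_eq Int_def flip: sum_distrib_left)
  also have "\<dots> \<le> (\<Sum>k<K. exp (c * (real k + 1)) * (M * exp (- real k)))"
    by (intro sum_mono mult_left_mono tail) auto
  also have "\<dots> = (\<Sum>k<K. M * exp c * r ^ k)"
    by (intro sum.cong) (auto simp: r_def algebra_simps simp flip: exp_of_nat_mult exp_add)
  also have "\<dots> = M * exp c * ((1 - r ^ K) / (1 - r))"
    using r by (simp add: sum_gp_strict flip: sum_distrib_left)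
  also have "\<dots> \<le> M * exp c * (1 / (1 - r))"
    using r M by (intro mult_left_mono divide_right_mono) auto
  finally show ?thesis by (simp add: r_def)
qed

lemma cw_Z_bounded:
  assumes "\<beta> > 0" "p \<in> U_set \<beta>" "even p"
  obtains C where "C > 0" "\<And>N. N \<ge> 1 \<Longrightarrow> cw_Z N \<beta> p \<le> C * 2 ^ N"
proof -
  from assms obtain \<gamma> where \<gamma>: "\<gamma> > \<beta>" "\<And>x. x \<in> {0..1} \<Longrightarrow> \<gamma> * x ^ p \<le> cw_entropy x"
    by (auto simp: U_set_def less_beta_star_iff)
  define c where "c = \<beta> / \<gamma>"
  have c: "0 \<le> c" "c < 1" using assms \<gamma>(1) by (auto simp: c_def)
  define C where "C = 2 * (exp c / (1 - exp (c - 1)))"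
  show thesis
  proof
    show "C > 0" using c by (simp add: C_def)
    fix N :: nat assume N: "N \<ge> 1"
    let ?f = "\<lambda>x. real N * cw_entropy \<bar>sample_mean N x\<bar>"
    have "\<beta> * real N * sample_mean N x ^ p \<le> c * ?f x" if x: "x \<in> spins N" for x
    proof -
      \<comment> \<open>Evenness of \<open>p\<close> allows the absolute value, so that the
        inequality on \<open>[0, 1]\<close> also covers negative means.\<close>
      have "\<beta> * sample_mean N x ^ p = c * (\<gamma> * \<bar>sample_mean N x\<bar> ^ p)"
        using assms \<gamma>(1) by (simp add: c_def power_even_abs)
      also have "\<dots> \<le> c * cw_entropy \<bar>sample_mean N x\<bar>"
        using abs_sample_mean_le[OF x N] c by (intro mult_left_mono \<gamma>) auto
      finally have "real N * (\<beta> * sample_mean N x ^ p) \<le> real N * (c * cw_entropy \<bar>sample_mean N x\<bar>)"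
        by (intro mult_left_mono) auto
      then show ?thesis by (simp add: algebra_simps)
    qed
    then have "cw_Z N \<beta> p \<le> (\<Sum>x\<in>spins N. exp (c * ?f x))"
      unfolding cw_Z_def by (intro sum_mono) simp
    also have "\<dots> \<le> 2 * 2 ^ N * (exp c / (1 - exp (c - 1)))"
      using abs_sample_mean_le[OF _ N] c card_entropy_ge[OF N]
      by (intro sum_exp_le_of_exp_tail finite_spins mult_nonneg_nonneg cw_entropy_nonneg) auto
    finally show "cw_Z N \<beta> p \<le> C * 2 ^ N" by (simp add: C_def mult_ac)
  qed
qed

section \<open>Comparison with the uniform measure and conclusion\<close>

lemma measure_curie_weiss:
  assumes "A \<subseteq> spins N"
  shows "measure (curie_weiss N \<beta> p) A =
    (\<Sum>x\<in>A. exp (\<beta> * real N * sample_mean N x ^ p) / cw_Z N \<beta> p)"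
proof -
  let ?w = "\<lambda>x. exp (\<beta> * real N * sample_mean N x ^ p) / cw_Z N \<beta> p"
  have w: "?w x \<ge> 0" for x by (simp add: cw_Z_pos less_imp_le)
  have "emeasure (curie_weiss N \<beta> p) A = (\<Sum>x\<in>A. ennreal (?w x))"
    unfolding curie_weiss_def using finite_spins assms by (rule emeasure_point_measure_finite)
  also have "\<dots> = ennreal (\<Sum>x\<in>A. ?w x)" using w by (intro sum_ennreal) auto
  finally show ?thesis by (simp add: measure_def w sum_nonneg)
qed

text \<open>For even \<open>p\<close> the exponent is nonnegative, so each unnormalized weight is at
  least \<open>1\<close> and counting is dominated by the unnormalized mass.\<close>

lemma card_le_measure_curie_weiss:
  assumes "\<beta> > 0" "even p" "A \<subseteq> spins N" "cw_Z N \<beta> p \<le> C * 2 ^ N"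
  shows "real (card A) \<le> C * 2 ^ N * measure (curie_weiss N \<beta> p) A"
proof -
  have "real (card A) = (\<Sum>x\<in>A. 1)" by simp
  also have "\<dots> \<le> (\<Sum>x\<in>A. exp (\<beta> * real N * sample_mean N x ^ p))"
    using assms by (intro sum_mono) (simp add: zero_le_even_power)
  also have "\<dots> = cw_Z N \<beta> p * measure (curie_weiss N \<beta> p) A"
    using cw_Z_pos[of N \<beta> p]
    by (simp add: measure_curie_weiss[OF assms(3)] flip: sum_divide_distrib)
  also have "\<dots> \<le> C * 2 ^ N * measure (curie_weiss N \<beta> p) A"
    by (intro mult_right_mono assms(4)) simp
  finally show ?thesis .
qed

theorem theorem2:
  fixes \<beta> :: real
  assumes "\<beta> > 0" and "U_set \<beta> \<noteq> {}"
  shows "\<not> (\<exists>T :: nat \<Rightarrow> (nat \<Rightarrow> real) \<Rightarrow> real. estimator_seq T \<and> consistent_on_U \<beta> T)"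
proof
  assume "\<exists>T :: nat \<Rightarrow> (nat \<Rightarrow> real) \<Rightarrow> real. estimator_seq T \<and> consistent_on_U \<beta> T"
  then obtain T where T: "consistent_on_U \<beta> T" by blast
  from assms(2) obtain r where r: "r \<in> U_set \<beta>" by blast
  \<comment> \<open>Both exponents are even and at least \<open>r\<close>; their gap
    \<open>4\<close> exceeds \<open>2\<close>, so no value lies within distance \<open>1\<close> of
    both.\<close>
  define p where "p = 2 * r"
  define q where "q = 2 * r + 4"
  have p: "p \<in> U_set \<beta>" "even p" and q: "q \<in> U_set \<beta>" "even q"
    using U_set_upward_closed[OF assms(1) r] by (auto simp: p_def q_def)
  obtain C where C: "C > 0" "\<And>N. N \<ge> 1 \<Longrightarrow> cw_Z N \<beta> p \<le> C * 2 ^ N"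
    using cw_Z_bounded[OF assms(1) p] by blast
  obtain D where D: "D > 0" "\<And>N. N \<ge> 1 \<Longrightarrow> cw_Z N \<beta> q \<le> D * 2 ^ N"
    using cw_Z_bounded[OF assms(1) q] by blast
  define A where "A = (\<lambda>N. {x\<in>spins N. \<bar>T N x - real p\<bar> > 1})"
  define B where "B = (\<lambda>N. {x\<in>spins N. \<bar>T N x - real q\<bar> > 1})"
  define a where "a = (\<lambda>N. measure (curie_weiss N \<beta> p) (A N))"
  define b where "b = (\<lambda>N. measure (curie_weiss N \<beta> q) (B N))"
  have "a \<longlonglongrightarrow> 0" "b \<longlonglongrightarrow> 0"
    using T p q unfolding consistent_on_U_def a_def b_def A_def B_def
    by (auto simp: space_curie_weiss)
  then have lim: "(\<lambda>N. C * a N + D * b N) \<longlonglongrightarrow> 0"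
    by (auto intro!: tendsto_eq_intros)
  have "1 \<le> C * a N + D * b N" if N: "N \<ge> 1" for N
  proof -
    have "spins N \<subseteq> A N \<union> B N" by (auto simp: A_def B_def p_def q_def)
    then have "card (spins N) \<le> card (A N \<union> B N)"
      by (intro card_mono) (auto simp: A_def B_def finite_spins)
    also have "\<dots> \<le> card (A N) + card (B N)" by (rule card_Un_le)
    finally have "2 ^ N \<le> card (A N) + card (B N)" by (simp add: card_spins)
    then have "(2::real) ^ N \<le> real (card (A N)) + real (card (B N))"
      by (metis of_nat_add of_nat_le_iff of_nat_numeral of_nat_power)
    also have "\<dots> \<le> C * 2 ^ N * a N + D * 2 ^ N * b N"
      unfolding a_def b_def using assms(1) p q C(2)[OF N] D(2)[OF N]
      by (intro add_mono card_le_measure_curie_weiss) (auto simp: A_def B_def)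
    \<comment> \<open>Dividing by \<open>2 ^ N\<close> leaves a lower bound of \<open>1\<close> for
      a sequence that tends to \<open>0\<close>.\<close>
    finally have "2 ^ N * 1 \<le> 2 ^ N * (C * a N + D * b N)" by (simp add: algebra_simps)
    then show ?thesis by (subst (asm) mult_le_cancel_left_pos) auto
  qed
  then have "1 \<le> (0::real)"
    by (intro LIMSEQ_le_const[OF lim]) blast
  then show False by simp
qed

end
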